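(* Let $p$ be a positive integer, and let $\pi_1,\pi_2,\pi_3$ be three probability distributions on $[p]=\{0,1,\ldots,p-1\}$, each of which is decreasing, i.e. $\pi_i(0)\ge\pi_i(1)\ge\cdots\ge\pi_i(p-1)$ for $i=1,2,3$. Suppose that their expected values satisfy $\mathbb{E}(\pi_1)+\mathbb{E}(\pi_2)+\mathbb{E}(\pi_3)=p-1$. Then $\pi_1,\pi_2,\pi_3$ are compatible.
   Context: For a positive integer $p$, $[p]$ denotes $\{0,1,\ldots,p-1\}$. For a probability distribution $\pi$ on a set of integers, $\pi(k)$ is the probability of the value $k$, and $\mathbb{E}(\pi)$ is the mean of $\pi$. Three probability distributions $\pi_1,\pi_2,\pi_3$ are called compatible if there exist (in general dependent) random variables $X_1,X_2,X_3$ on a common probability space such that $X_i$ has distribution $\pi_i$ for each $i$ and $X_1+X_2+X_3$ is constant. *)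

theory Defs
  imports "HOL-Probability.Probability"
begin

text \<open>
  HOL cannot quantify existentially over types, so the type of sample points in the definition
  of \<open>compatible\<close> has to be fixed.  Triples of integers suffice: lemma \<open>compatibleI\<close> shows that
  random variables on a probability space over an arbitrary type, whose sum need only be
  constant almost surely, already yield compatibility.
\<close>

definition compatible :: "int pmf \<Rightarrow> int pmf \<Rightarrow> int pmf \<Rightarrow> bool" where
  "compatible \<pi>\<^sub>1 \<pi>\<^sub>2 \<pi>\<^sub>3 \<longleftrightarrow>
    (\<exists>(M :: (int \<times> int \<times> int) measure) X\<^sub>1 X\<^sub>2 X\<^sub>3.
       prob_space M \<and>
       X\<^sub>1 \<in> measurable M (count_space UNIV) \<and> distr M (count_space UNIV) X\<^sub>1 = measure_pmf \<pi>\<^sub>1 \<and>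
       X\<^sub>2 \<in> measurable M (count_space UNIV) \<and> distr M (count_space UNIV) X\<^sub>2 = measure_pmf \<pi>\<^sub>2 \<and>
       X\<^sub>3 \<in> measurable M (count_space UNIV) \<and> distr M (count_space UNIV) X\<^sub>3 = measure_pmf \<pi>\<^sub>3 \<and>
       (\<exists>c. \<forall>\<omega>\<in>space M. X\<^sub>1 \<omega> + X\<^sub>2 \<omega> + X\<^sub>3 \<omega> = c))"

lemma compatibleI:
  fixes M :: "'a measure" and X\<^sub>1 X\<^sub>2 X\<^sub>3 :: "'a \<Rightarrow> int"
  assumes M: "prob_space M"
    and X1: "X\<^sub>1 \<in> measurable M (count_space UNIV)" "distr M (count_space UNIV) X\<^sub>1 = measure_pmf \<pi>\<^sub>1"
    and X2: "X\<^sub>2 \<in> measurable M (count_space UNIV)" "distr M (count_space UNIV) X\<^sub>2 = measure_pmf \<pi>\<^sub>2"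
    and X3: "X\<^sub>3 \<in> measurable M (count_space UNIV)" "distr M (count_space UNIV) X\<^sub>3 = measure_pmf \<pi>\<^sub>3"
    and c: "AE \<omega> in M. X\<^sub>1 \<omega> + X\<^sub>2 \<omega> + X\<^sub>3 \<omega> = c"
  shows "compatible \<pi>\<^sub>1 \<pi>\<^sub>2 \<pi>\<^sub>3"
proof -
  define Z where "Z = (\<lambda>\<omega>. (X\<^sub>1 \<omega>, X\<^sub>2 \<omega>, X\<^sub>3 \<omega>))"
  define N where "N = distr M (count_space UNIV) Z"
  have [measurable]: "X\<^sub>1 \<in> measurable M (count_space UNIV)" "X\<^sub>2 \<in> measurable M (count_space UNIV)"
    "X\<^sub>3 \<in> measurable M (count_space UNIV)" using X1 X2 X3 by auto
  have Z: "Z \<in> measurable M (count_space UNIV)"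
    unfolding Z_def by measurable
  interpret prob_space M by (fact M)
  have "prob_space N" unfolding N_def using Z by (rule prob_space_distr)
  have d: "distr N (count_space UNIV) f = distr M (count_space UNIV) (f \<circ> Z)" for f :: "_ \<Rightarrow> int"
    unfolding N_def by (rule distr_distr) (use Z in auto)
  have "distr M (count_space UNIV) (\<lambda>\<omega>. c - X\<^sub>1 \<omega> - X\<^sub>2 \<omega>) = distr M (count_space UNIV) X\<^sub>3"
  proof (rule distr_cong_AE)
    show "AE \<omega> in M. c - X\<^sub>1 \<omega> - X\<^sub>2 \<omega> = X\<^sub>3 \<omega>" using c by eventually_elim simp
  qed auto
  then have 3: "distr N (count_space UNIV) (\<lambda>(x, y, z). c - x - y) = measure_pmf \<pi>\<^sub>3"
    unfolding d using X3 by (simp add: Z_def o_def)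
  have 1: "distr N (count_space UNIV) fst = measure_pmf \<pi>\<^sub>1"
    unfolding d using X1 by (simp add: Z_def o_def)
  have 2: "distr N (count_space UNIV) (fst \<circ> snd) = measure_pmf \<pi>\<^sub>2"
    unfolding d using X2 by (simp add: Z_def o_def)
  have m: "f \<in> measurable N (count_space UNIV)" for f :: "_ \<Rightarrow> int"
    unfolding N_def by simp
  show ?thesis
    unfolding compatible_def
    using \<open>prob_space N\<close> 1 2 3 m
    by (intro exI[of _ N] exI[of _ fst] exI[of _ "fst \<circ> snd"] exI[of _ "\<lambda>(x, y, z). c - x - y"] conjI
        exI[of _ c]) auto
qed

end

theory Submission
  imports Defs
begin

text \<open>
  Put \<open>s = p - 1\<close> and induct on \<open>s\<close>, working with the cone of measure triples on \<open>{0..s}\<close> that are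
  coupled with constant sum \<open>s\<close>. If at least two of the three measures, say \<open>g\<close> and \<open>h\<close>, vanish at \<open>s\<close>,
  couple the atom of \<open>f\<close> at 0 with a multiple of \<open>min (g j) (h (s - j))\<close> on the antidiagonal. The
  rest of \<open>f\<close> is shifted down by one, monotonicity and the mean condition survive, and the induction
  hypothesis for \<open>s - 1\<close> applies. The mean condition is exactly what makes the mass of the minimum at
  least \<open>f 0\<close>.

  If two measures charge \<open>s\<close>, subtract the largest possible multiple of a coupled triple of decreasing
  measures whose jumps are among the jumps of the given ones. This destroys a jump, so the process
  terminates. The triple can be chosen so that either at most one of its members charges \<open>s\<close>, or two
  members are uniform on \<open>{0..s}\<close> and \<open>{0..j}\<close> and the third is a mixture of the uniform measures on
  \<open>{0..k}\<close> and \<open>{0..s}\<close>. In the latter case, conditioning on whether the third variable is at most \<open>k\<close>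
  leaves two triples of uniform measures on translated intervals.
\<close>

section \<open>Coupled triples and their closure properties\<close>

text \<open>The marginals of finite non-negative weights on the points \<open>(i, j, k)\<close> with
  \<open>i + j + k = s\<close>. Generating this cone by point masses gives each closure property by
  one rule induction; \<open>coupled_weights\<close> recovers the weights.\<close>

inductive coupled :: "nat \<Rightarrow> (nat \<Rightarrow> real) \<Rightarrow> (nat \<Rightarrow> real) \<Rightarrow> (nat \<Rightarrow> real) \<Rightarrow> bool" for s where
  zero: "coupled s (\<lambda>_. 0) (\<lambda>_. 0) (\<lambda>_. 0)"
| add_point: "coupled s f g h \<Longrightarrow> i + j + k = s \<Longrightarrow> 0 \<le> c \<Longrightarrow>
    coupled s (f(i := f i + c)) (g(j := g j + c)) (h(k := h k + c))"

definition moment :: "nat \<Rightarrow> (nat \<Rightarrow> real) \<Rightarrow> real" where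
  "moment s f = (\<Sum>i\<le>s. real i * f i)"

text \<open>Antitonicity on all naturals together with vanishing beyond \<open>s\<close> forces
  non-negativity and makes \<open>s\<close> a jump as soon as \<open>f s > 0\<close>. The mass
  \<open>m\<close> is arbitrary because the induction subtracts measures.\<close>

definition profile :: "nat \<Rightarrow> real \<Rightarrow> (nat \<Rightarrow> real) \<Rightarrow> bool" where
  "profile s m f \<longleftrightarrow> antimono f \<and> (\<forall>i>s. f i = 0) \<and> (\<Sum>i\<le>s. f i) = m"

definition balanced :: "nat \<Rightarrow> real \<Rightarrow> (nat \<Rightarrow> real) \<Rightarrow> (nat \<Rightarrow> real) \<Rightarrow> (nat \<Rightarrow> real) \<Rightarrow> bool" where
  "balanced s m f g h \<longleftrightarrow> profile s m f \<and> profile s m g \<and> profile s m h \<and>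
     moment s f + moment s g + moment s h = real s * m"

definition shift :: "nat \<Rightarrow> (nat \<Rightarrow> real) \<Rightarrow> nat \<Rightarrow> real" where
  "shift r f = (\<lambda>i. if i < r then 0 else f (i - r))"

definition unif :: "nat \<Rightarrow> nat \<Rightarrow> real" where
  "unif k = (\<lambda>i. if i \<le> k then 1 / (real k + 1) else 0)"

lemma coupled_cong:
  "coupled s f g h \<Longrightarrow> (\<And>i. f i = f' i) \<Longrightarrow> (\<And>i. g i = g' i) \<Longrightarrow> (\<And>i. h i = h' i) \<Longrightarrow>
    coupled s f' g' h'"
  by (metis ext)

lemma coupled_swap12: "coupled s f g h \<Longrightarrow> coupled s g f h"
proof (induction rule: coupled.induct)
  case (add_point f g h i j k c)
  then show ?case using coupled.add_point[of s g f h j i k c] by (simp add: ac_simps del: fun_upd_apply)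
qed (rule zero)

lemma coupled_swap23: "coupled s f g h \<Longrightarrow> coupled s f h g"
proof (induction rule: coupled.induct)
  case (add_point f g h i j k c)
  then show ?case using coupled.add_point[of s f h g i k j c] by (simp add: ac_simps del: fun_upd_apply)
qed (rule zero)

lemma coupled_add:
  assumes "coupled s f g h" "coupled s f' g' h'"
  shows "coupled s (\<lambda>i. f i + f' i) (\<lambda>i. g i + g' i) (\<lambda>i. h i + h' i)"
  using assms(2)
proof (induction rule: coupled.induct)
  case zero
  then show ?case using assms(1) by simp
next
  case (add_point f' g' h' i j k c)
  show ?case
    by (rule coupled_cong[OF coupled.add_point[OF add_point.IH add_point.hyps(2,3)]]) auto
qed

lemma coupled_scale:
  assumes "coupled s f g h" "0 \<le> t"
  shows "coupled s (\<lambda>i. t * f i) (\<lambda>i. t * g i) (\<lambda>i. t * h i)"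
  using assms(1)
proof (induction rule: coupled.induct)
  case zero
  then show ?case using coupled.zero by simp
next
  case (add_point f g h i j k c)
  show ?case
    by (rule coupled_cong[OF coupled.add_point[OF add_point.IH add_point.hyps(2), of "t * c"]])
      (use add_point.hyps(3) assms(2) in \<open>auto simp: algebra_simps\<close>)
qed

lemma coupled_shift:
  assumes "coupled s f g h"
  shows "coupled (s + r) (shift r f) g h"
  using assms
proof (induction rule: coupled.induct)
  case zero
  then show ?case using coupled.zero by (simp add: shift_def)
next
  case (add_point f g h i j k c)
  have "i + r + j + k = s + r" using add_point.hyps by simp
  show ?case
    by (rule coupled_cong[OF coupled.add_point[OF add_point.IH \<open>i + r + j + k = s + r\<close> add_point.hyps(3)]])
      (auto simp: shift_def)
qed

text \<open>The coupling puts weight \<open>q j\<close> at \<open>(0, j, s - j)\<close>; the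
  induction adds these points one at a time.\<close>

lemma coupled_reflect:
  assumes "\<And>j. 0 \<le> q j"
  shows "coupled s (\<lambda>i. if i = 0 then \<Sum>j\<le>s. q j else 0) (\<lambda>j. if j \<le> s then q j else 0)
           (\<lambda>k. if k \<le> s then q (s - k) else 0)"
proof -
  have "coupled s (\<lambda>i. if i = 0 then \<Sum>j<t. q j else 0) (\<lambda>j. if j < t then q j else 0)
     (\<lambda>k. if k \<le> s \<and> s - k < t then q (s - k) else 0)" if "t \<le> Suc s" for t
    using that
  proof (induction t)
    case 0
    show ?case by (rule coupled_cong[OF coupled.zero]) auto
  next
    case (Suc t)
    then have "t \<le> s" "t \<le> Suc s" "0 + t + (s - t) = s" by auto
    show ?case
      by (rule coupled_cong[OF coupled.add_point[OF Suc.IH[OF \<open>t \<le> Suc s\<close>] \<open>0 + t + (s - t) = s\<close>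
            assms[of t]]])
        (use \<open>t \<le> s\<close> in \<open>auto simp: less_Suc_eq\<close>)
  qed
  from this[of "Suc s"] show ?thesis
    by (rule coupled_cong) (auto simp: lessThan_Suc_atMost)
qed

lemma sum_fun_upd_add:
  fixes f :: "nat \<Rightarrow> real"
  assumes "i \<le> s"
  shows "(\<Sum>l\<le>s. w l * (f(i := f i + c)) l) = (\<Sum>l\<le>s. w l * f l) + w i * c"
proof -
  have "(\<Sum>l\<le>s. w l * (f(i := f i + c)) l) = (\<Sum>l\<le>s. w l * f l + (if l = i then w i * c else 0))"
    by (rule sum.cong) (auto simp: algebra_simps)
  then show ?thesis using assms by (simp add: sum.distrib)
qed

text \<open>A point of weight \<open>c\<close> adds \<open>c\<close> to each mass and
  \<open>(i + j + k) * c = s * c\<close> to the total moment. Hence subtracting a coupled triple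
  preserves the mean condition.\<close>

lemma coupled_mass_moment:
  assumes "coupled s f g h"
  shows "(\<Sum>i\<le>s. g i) = (\<Sum>i\<le>s. f i)" "(\<Sum>i\<le>s. h i) = (\<Sum>i\<le>s. f i)"
    "moment s f + moment s g + moment s h = real s * (\<Sum>i\<le>s. f i)"
    "i > s \<Longrightarrow> f i = 0" "i > s \<Longrightarrow> g i = 0" "i > s \<Longrightarrow> h i = 0"
proof -
  have "(\<Sum>i\<le>s. 1 * g i) = (\<Sum>i\<le>s. 1 * f i) \<and> (\<Sum>i\<le>s. 1 * h i) = (\<Sum>i\<le>s. 1 * f i) \<and>
    moment s f + moment s g + moment s h = real s * (\<Sum>i\<le>s. 1 * f i) \<and>
    (\<forall>i>s. f i = 0 \<and> g i = 0 \<and> h i = 0)"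
    using assms
  proof (induction rule: coupled.induct)
    case zero
    then show ?case by (simp add: moment_def)
  next
    case (add_point f g h i j k c)
    have le: "i \<le> s" "j \<le> s" "k \<le> s" using add_point.hyps by auto
    have "real i * c + real j * c + real k * c = real s * c"
      using add_point.hyps(2) by (metis distrib_right of_nat_add)
    moreover have "\<forall>l>s. (f(i := f i + c)) l = 0 \<and> (g(j := g j + c)) l = 0 \<and> (h(k := h k + c)) l = 0"
      using add_point.IH le by auto
    ultimately show ?case
      using add_point.IH le unfolding moment_def
      by (simp only: sum_fun_upd_add sum_fun_upd_add[where w = "\<lambda>_. 1"]) (simp add: algebra_simps del: fun_upd_apply)
  qed
  then show "(\<Sum>i\<le>s. g i) = (\<Sum>i\<le>s. f i)" "(\<Sum>i\<le>s. h i) = (\<Sum>i\<le>s. f i)"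
    "moment s f + moment s g + moment s h = real s * (\<Sum>i\<le>s. f i)"
    "i > s \<Longrightarrow> f i = 0" "i > s \<Longrightarrow> g i = 0" "i > s \<Longrightarrow> h i = 0" by auto
qed

section \<open>Moment bounds for decreasing measures\<close>

lemma profile_nonneg: "profile s m f \<Longrightarrow> 0 \<le> f i"
  unfolding profile_def antimono_def by (metis le_cases le_less_trans lessI less_imp_le not_le)

lemma profile_mono: "profile s m f \<Longrightarrow> i \<le> j \<Longrightarrow> f j \<le> f i"
  by (auto simp: profile_def antimono_def)

lemma balanced_swap12: "balanced s m f g h \<Longrightarrow> balanced s m g f h"
  and balanced_swap23: "balanced s m f g h \<Longrightarrow> balanced s m f h g"
  by (auto simp: balanced_def)

text \<open>Each earlier weight is at least \<open>f l\<close>, so \<open>l * f l\<close> is at most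
  the mass so far. This is exactly what the step from \<open>l\<close> to \<open>Suc l\<close>
  needs.\<close>

lemma antimono_moment_le:
  fixes f :: "nat \<Rightarrow> real"
  assumes "antimono f"
  shows "2 * (\<Sum>k<l. real k * f k) \<le> (real l - 1) * (\<Sum>k<l. f k)"
proof (induction l)
  case (Suc l)
  have "(\<Sum>k<l. f l) \<le> (\<Sum>k<l. f k)"
    using assms by (intro sum_mono) (auto simp: antimono_def)
  then show ?case using Suc by (simp add: algebra_simps)
qed simp

text \<open>On each of \<open>{0..<t}\<close> and \<open>{t..s}\<close> the mean is at most the
  midpoint, that is \<open>(t - 1) / 2\<close> and \<open>(t + s) / 2\<close>. Expressing the mass
  of the first block as \<open>m\<close> minus the tail gives the bound.\<close>

lemma moment_le_tail:
  assumes "profile s m f" "t \<le> Suc s"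
  shows "2 * moment s f \<le> (real t - 1) * m + (real s + 1) * (\<Sum>j\<in>{t..s}. f j)"
proof -
  have am: "antimono f" "antimono (\<lambda>k. f (t + k))"
    using assms(1) by (auto simp: profile_def antimono_def)
  have split: "(\<Sum>j\<le>s. F j) = (\<Sum>j<t. F j) + (\<Sum>j\<in>{t..s}. F j)" for F :: "nat \<Rightarrow> real"
    using assms(2) by (subst sum.union_disjoint[symmetric]) (auto intro!: sum.cong)
  have sh: "(\<Sum>j\<in>{t..s}. F j) = (\<Sum>k<Suc s - t. F (t + k))" for F :: "nat \<Rightarrow> real"
    by (rule sum.reindex_bij_witness[of _ "\<lambda>k. t + k" "\<lambda>j. j - t"]) auto
  define G where "G = (\<Sum>j\<in>{t..s}. f j)"
  define M where "M = (\<Sum>j<t. f j)"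
  have m: "m = M + G" using assms(1) split[of f] by (simp add: profile_def G_def M_def)
  have 1: "2 * (\<Sum>j<t. real j * f j) \<le> (real t - 1) * M"
    unfolding M_def using am(1) by (rule antimono_moment_le)
  have "2 * (\<Sum>k<Suc s - t. real k * f (t + k)) \<le> (real (Suc s - t) - 1) * G"
    unfolding G_def sh using am(2) by (rule antimono_moment_le)
  moreover have "(\<Sum>j\<in>{t..s}. real j * f j) = real t * G + (\<Sum>k<Suc s - t. real k * f (t + k))"
    unfolding G_def sh by (simp add: sum.distrib sum_distrib_left algebra_simps)
  ultimately have 2: "2 * (\<Sum>j\<in>{t..s}. real j * f j) \<le> (real t + real s) * G"
    using assms(2) by (simp add: of_nat_diff algebra_simps)
  show ?thesis
    unfolding moment_def split[of "\<lambda>i. real i * f i"] G_def[symmetric] m using 1 2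
    by (simp add: algebra_simps)
qed

lemma sum_min_ge:
  assumes "balanced s m f g h"
  shows "f 0 \<le> (\<Sum>j\<le>s. min (g j) (h (s - j)))"
proof -
  have pr: "profile s m f" "profile s m g" "profile s m h"
    and mom: "moment s f + moment s g + moment s h = real s * m"
    using assms by (auto simp: balanced_def)
  txt \<open>The minimum switches from \<open>h (s - j)\<close> to \<open>g j\<close> at \<open>t\<close>, so its sum is a sum of two tails.\<close>
  define t where "t = (LEAST j. j = Suc s \<or> g j < h (s - j))"
  have t_le: "t \<le> Suc s" unfolding t_def by (rule Least_le) simp
  have t: "t = Suc s \<or> g t < h (s - t)" unfolding t_def by (rule LeastI[of _ "Suc s"]) simp
  have below: "h (s - j) \<le> g j" if "j < t" for j
    using not_less_Least[OF that[unfolded t_def]] by auto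
  have above: "g j \<le> h (s - j)" if "t \<le> j" "j \<le> s" for j
  proof -
    have "g j \<le> g t" "h (s - t) \<le> h (s - j)" using that by (auto intro: profile_mono[OF pr(2)] profile_mono[OF pr(3)])
    then show ?thesis using t that by auto
  qed
  have "(\<Sum>j\<le>s. min (g j) (h (s - j))) =
      (\<Sum>j<t. min (g j) (h (s - j))) + (\<Sum>j\<in>{t..s}. min (g j) (h (s - j)))"
    using t_le by (subst sum.union_disjoint[symmetric]) (auto intro!: sum.cong)
  also have "(\<Sum>j<t. min (g j) (h (s - j))) = (\<Sum>j<t. h (s - j))"
    using below by (intro sum.cong) (auto simp: min_def antisym)
  also have "\<dots> = (\<Sum>k\<in>{Suc s - t..s}. h k)"
    using t_le by (intro sum.reindex_bij_witness[of _ "\<lambda>k. s - k" "\<lambda>j. s - j"]) auto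
  also have "(\<Sum>j\<in>{t..s}. min (g j) (h (s - j))) = (\<Sum>j\<in>{t..s}. g j)"
    using above by (intro sum.cong) (auto simp: min_def)
  finally have eq: "(\<Sum>j\<le>s. min (g j) (h (s - j))) = (\<Sum>k\<in>{Suc s - t..s}. h k) + (\<Sum>j\<in>{t..s}. g j)" .
  have f0: "(\<Sum>j\<in>{1..s}. f j) = m - f 0"
    using pr(1) by (simp add: profile_def atMost_atLeast0 sum.atLeast_Suc_atMost)
  have "2 * moment s f \<le> (real s + 1) * (m - f 0)"
    using moment_le_tail[OF pr(1), of 1] f0 by simp
  moreover have "2 * moment s g \<le> (real t - 1) * m + (real s + 1) * (\<Sum>j\<in>{t..s}. g j)"
    using moment_le_tail[OF pr(2) t_le] .
  moreover have "2 * moment s h \<le> (real s - real t) * m + (real s + 1) * (\<Sum>k\<in>{Suc s - t..s}. h k)"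
    using moment_le_tail[OF pr(3), of "Suc s - t"] t_le by (simp add: of_nat_diff)
  \<comment> \<open>On the right \<open>m\<close> has the coefficient
    \<open>(s + 1) + (t - 1) + (s - t) = 2 * s\<close>. It cancels against the left, and the
    switching point \<open>t\<close> drops out.\<close>
  ultimately have "2 * (real s * m) \<le> (real s + 1) * (m - f 0) + (real t - 1) * m +
     (real s - real t) * m + (real s + 1) * (\<Sum>j\<le>s. min (g j) (h (s - j)))"
    unfolding eq mom[symmetric] by (simp add: algebra_simps)
  then have "(real s + 1) * f 0 \<le> (real s + 1) * (\<Sum>j\<le>s. min (g j) (h (s - j)))"
    by (simp add: algebra_simps)
  then show ?thesis by (simp add: mult_le_cancel_left_pos)
qed

section \<open>Peeling off the atom at 0\<close>

lemma coupled_peel: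
  assumes IH: "\<forall>m f g h. balanced s m f g h \<longrightarrow> coupled s f g h"
    and bal: "balanced (Suc s) m f g h" and top: "g (Suc s) = 0" "h (Suc s) = 0"
  shows "coupled (Suc s) f g h"
proof -
  define p where "p = Suc s"
  have pr: "profile p m f" "profile p m g" "profile p m h"
    and mom: "moment p f + moment p g + moment p h = real p * m"
    using bal by (auto simp: balanced_def p_def)
  define S where "S = (\<Sum>j\<le>p. min (g j) (h (p - j)))"
  \<comment> \<open>This scale gives the antidiagonal weights \<open>q\<close> the mass
    \<open>f 0\<close>. If \<open>S = 0\<close>, then \<open>f 0 = 0\<close> and the default value 0
    of the division is the right one.\<close>
  define \<theta> where "\<theta> = f 0 / S"
  define q where "q = (\<lambda>j. \<theta> * min (g j) (h (p - j)))"
  have f0: "0 \<le> f 0" "f 0 \<le> S"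
    using profile_nonneg[OF pr(1)] sum_min_ge[OF bal] by (auto simp: S_def p_def)
  have \<theta>: "0 \<le> \<theta>" "\<theta> \<le> 1" and \<theta>S: "\<theta> * S = f 0"
    using f0 by (auto simp: \<theta>_def divide_le_eq_1)
  have q0: "0 \<le> q j" for j
    using \<theta> profile_nonneg[OF pr(2)] profile_nonneg[OF pr(3)] by (simp add: q_def)
  have qsum: "(\<Sum>j\<le>p. q j) = f 0"
    using \<theta>S by (simp add: q_def S_def sum_distrib_left)
  have qr: "q (p - k) = \<theta> * min (h k) (g (p - k))" if "k \<le> p" for k
    using that by (simp add: q_def min.commute)
  define f' where "f' = (\<lambda>i. f (Suc i))"
  define g' where "g' = (\<lambda>j. g j - \<theta> * min (g j) (h (p - j)))"
  define h' where "h' = (\<lambda>j. h j - \<theta> * min (h j) (g (p - j)))"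
  \<comment> \<open>The map \<open>b - \<theta> * min b c\<close> increases in \<open>b\<close>
    because \<open>\<theta> \<le> 1\<close>, and decreases in \<open>c\<close>. As \<open>j\<close>
    grows, \<open>g j\<close> falls and \<open>h (p - j)\<close> rises, so the remainder of
    \<open>g\<close> stays decreasing; likewise for \<open>h\<close>.\<close>
  have F: "b - \<theta> * min b c' \<le> a - \<theta> * min a c" if "b \<le> a" "c \<le> c'" for a b c c' :: real
  proof -
    have "b - \<theta> * min b c' \<le> b - \<theta> * min b c" using \<theta> that by (auto intro!: mult_left_mono)
    moreover have "\<theta> * (min a c - min b c) \<le> 1 * (a - b)"
      using \<theta> that by (intro mult_mono) auto
    ultimately show ?thesis by (simp add: algebra_simps)
  qed
  have am: "antimono g'" "antimono h'"
    unfolding g'_def h'_def antimono_def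
    by (auto intro!: F profile_mono[OF pr(2)] profile_mono[OF pr(3)])
  have z: "g' i = 0" "h' i = 0" if "i > s" for i
  proof -
    have "g i = 0" "h i = 0"
      using that top pr(2,3) by (auto simp: profile_def p_def) (metis Suc_lessI)+
    then show "g' i = 0" "h' i = 0"
      using profile_nonneg[OF pr(2)] profile_nonneg[OF pr(3)] by (auto simp: g'_def h'_def)
  qed
  have rev: "(\<Sum>k\<le>p. F (p - k)) = (\<Sum>j\<le>p. F j)" for F :: "nat \<Rightarrow> real"
    by (rule sum.reindex_bij_witness[of _ "\<lambda>k. p - k" "\<lambda>j. p - j"]) auto
  have g'_q: "g' j = g j - q j" for j by (simp add: g'_def q_def)
  have h'_q: "h' k = h k - q (p - k)" if "k \<le> p" for k using that by (simp add: h'_def qr)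
  have pf: "profile s (m - f 0) f'"
    using pr(1) by (auto simp: profile_def p_def f'_def antimono_def sum.atMost_Suc_shift
      simp del: sum.atMost_Suc)
  have sg: "(\<Sum>i\<le>s. g' i) = m - f 0"
  proof -
    have "(\<Sum>i\<le>s. g' i) = (\<Sum>i\<le>p. g' i)" using z by (simp add: p_def)
    also have "\<dots> = m - f 0" using pr(2) qsum by (simp add: g'_q sum_subtractf profile_def)
    finally show ?thesis .
  qed
  have sh: "(\<Sum>i\<le>s. h' i) = m - f 0"
  proof -
    have "(\<Sum>i\<le>s. h' i) = (\<Sum>i\<le>p. h' i)" using z by (simp add: p_def)
    also have "\<dots> = (\<Sum>i\<le>p. h i - q (p - i))" by (intro sum.cong) (auto simp: h'_q)
    also have "\<dots> = m - f 0" using pr(3) qsum rev[of q] by (simp add: sum_subtractf profile_def)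
    finally show ?thesis .
  qed
  \<comment> \<open>Shifting lowers the moment by the remaining mass \<open>m - f 0\<close>, and the
    antidiagonal takes \<open>p * f 0\<close> from \<open>g\<close> and \<open>h\<close> together.
    What is left of \<open>p * m\<close> is \<open>s * (m - f 0)\<close>.\<close>
  have mf: "moment s f' = moment p f - (m - f 0)"
  proof -
    have "moment p f = (\<Sum>i\<le>s. real (Suc i) * f' i)"
      unfolding moment_def p_def f'_def sum.atMost_Suc_shift by simp
    also have "\<dots> = moment s f' + (\<Sum>i\<le>s. f' i)"
      by (simp add: moment_def sum.distrib algebra_simps)
    finally show ?thesis using pf by (simp add: profile_def)
  qed
  have mg: "moment s g' = moment p g - (\<Sum>j\<le>p. real j * q j)"
  proof -
    have "moment s g' = moment p g'" using z[of p] by (simp add: moment_def p_def)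
    then show ?thesis by (simp add: moment_def g'_q sum_subtractf algebra_simps)
  qed
  have mh: "moment s h' = moment p h - (real p * f 0 - (\<Sum>j\<le>p. real j * q j))"
  proof -
    have "moment s h' = moment p h'" using z[of p] by (simp add: moment_def p_def)
    also have "\<dots> = (\<Sum>k\<le>p. real k * h k - real k * q (p - k))"
      unfolding moment_def by (intro sum.cong) (auto simp: h'_q algebra_simps)
    also have "\<dots> = moment p h - (\<Sum>k\<le>p. real k * q (p - k))"
      by (simp add: sum_subtractf moment_def)
    also have "(\<Sum>k\<le>p. real k * q (p - k)) = (\<Sum>k\<le>p. real (p - (p - k)) * q (p - k))"
      by (intro sum.cong) auto
    also have "\<dots> = (\<Sum>j\<le>p. real (p - j) * q j)" by (rule rev)
    also have "\<dots> = (\<Sum>j\<le>p. real p * q j - real j * q j)"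
      by (intro sum.cong) (auto simp: of_nat_diff algebra_simps)
    also have "\<dots> = real p * f 0 - (\<Sum>j\<le>p. real j * q j)"
      by (simp add: sum_subtractf sum_distrib_left[symmetric] qsum)
    finally show ?thesis .
  qed
  have "balanced s (m - f 0) f' g' h'"
    using pf am z sg sh mf mg mh mom
    by (simp add: balanced_def profile_def p_def algebra_simps)
  from coupled_shift[OF IH[rule_format, OF this], of 1]
  have "coupled p (shift 1 f') g' h'" by (simp add: p_def)
  from coupled_add[OF this coupled_reflect[of q p, OF q0]] show ?thesis
    unfolding p_def[symmetric]
  proof (rule coupled_cong)
    fix i
    show "shift 1 f' i + (if i = 0 then \<Sum>j\<le>p. q j else 0) = f i"
      by (auto simp: shift_def f'_def qsum)
    have "g' i = 0 \<and> g i = 0 \<and> h' i = 0 \<and> h i = 0" if "\<not> i \<le> p"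
      using z[of i] pr that by (auto simp: profile_def p_def)
    then show "g' i + (if i \<le> p then q i else 0) = g i"
      "h' i + (if i \<le> p then q (p - i) else 0) = h i"
      by (auto simp: g'_q h'_q)
  qed
qed

section \<open>Uniform measures and their mixtures\<close>

lemma scale_unif: "(real k + 1) * unif k i = (if i \<le> k then 1 else 0)"
  by (simp add: unif_def)

lemma sum_unif:
  assumes "k \<le> p"
  shows "(\<Sum>i\<le>p. w i * unif k i) = (\<Sum>i\<le>k. w i) / (real k + 1)"
proof -
  have "(\<Sum>i\<le>p. w i * unif k i) = (\<Sum>i\<le>k. w i * unif k i)"
    using assms by (intro sum.mono_neutral_right) (auto simp: unif_def)
  then show ?thesis by (simp add: unif_def sum_divide_distrib)
qed

lemma moment_unif: "k \<le> p \<Longrightarrow> moment p (unif k) = real k / 2"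
proof -
  assume "k \<le> p"
  have "(\<Sum>i\<le>k. real i) = real k * (real k + 1) / 2"
    by (induction k) (auto simp: field_simps)
  then show ?thesis using \<open>k \<le> p\<close> by (simp add: moment_def sum_unif field_simps)
qed

lemma antimono_unif: "antimono (unif k)"
  by (auto simp: antimono_def unif_def)

lemma profile_unif: "k \<le> p \<Longrightarrow> profile p 1 (unif k)"
  using sum_unif[of k p "\<lambda>_. 1"] by (auto simp: profile_def antimono_unif) (simp add: unif_def)

lemma balanced_unif:
  assumes "i \<le> p" "j \<le> p" "k \<le> p" "i + j + k = 2 * p"
  shows "balanced p 1 (unif i) (unif j) (unif k)"
proof -
  have "real i + real j + real k = 2 * real p" using assms(4) by linarith
  then show ?thesis using assms by (simp add: balanced_def profile_unif moment_unif)
qed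

text \<open>If \<open>i\<close> and \<open>j\<close> are positive, neither of the two shorter
  measures charges \<open>i + j\<close>, so peeling needs the hypothesis only for
  \<open>i + j - 1\<close>, which admits \<open>i + j = p\<close>. If one of them is 0, it gives the
  point mass at 0, and the other two measures coincide and are coupled by reflection.\<close>

lemma coupled_unif:
  assumes IH: "\<forall>s<p. \<forall>m f g h. balanced s m f g h \<longrightarrow> coupled s f g h"
    and "i + j \<le> p"
  shows "coupled (i + j) (unif (i + j)) (unif i) (unif j)"
proof -
  have r: "coupled n (unif 0) (unif n) (unif n)" for n
    by (rule coupled_cong[OF coupled_reflect[of "\<lambda>_. 1 / (real n + 1)" n]])
      (auto simp: unif_def divide_simps)
  consider "i = 0" | "j = 0" | "i > 0" "j > 0" by auto
  then show ?thesis
  proof cases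
    case 1
    then show ?thesis using coupled_swap12[OF r[of j]] by simp
  next
    case 2
    then show ?thesis using coupled_swap23[OF coupled_swap12[OF r[of i]]] by simp
  next
    case 3
    then obtain s where s: "i + j = Suc s" by (cases "i + j") auto
    have "s < p" using s \<open>i + j \<le> p\<close> by simp
    have "coupled (Suc s) (unif (Suc s)) (unif i) (unif j)"
    proof (rule coupled_peel)
      show "\<forall>m f g h. balanced s m f g h \<longrightarrow> coupled s f g h"
        using \<open>s < p\<close> IH by blast
      show "balanced (Suc s) 1 (unif (Suc s)) (unif i) (unif j)"
        using s by (intro balanced_unif) auto
    qed (use s 3 in \<open>auto simp: unif_def\<close>)
    then show ?thesis by (simp add: s)
  qed
qed

text \<open>
  The mixture of the uniform measures on \<open>{0..k}\<close> and \<open>{0..p}\<close> that is balanced against those on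
  \<open>{0..p}\<close> and \<open>{0..j}\<close>, with total mass \<open>p + 1\<close>, cut into its parts on \<open>{0..k}\<close> and \<open>{k+1..p}\<close>.
  For \<open>k = p\<close> (hence \<open>j = 0\<close>) the second summand is a truncated-subtraction artefact with
  coefficient 0.
\<close>
definition split_unif :: "nat \<Rightarrow> nat \<Rightarrow> nat \<Rightarrow> nat \<Rightarrow> real" where
  "split_unif p j k = (\<lambda>i. (real j + real k + 1) * unif k i +
     real (p - j - k) * shift (Suc k) (unif (p - k - 1)) i)"

text \<open>With \<open>r = p - j - k\<close>, one part couples the uniform measures on
  \<open>{r..p}\<close>, \<open>{0..j}\<close>, \<open>{0..k}\<close>, the other those on
  \<open>{0..<r}\<close>, \<open>{0..j}\<close>, \<open>{k+1..p}\<close>. The weights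
  \<open>j + k + 1\<close> and \<open>r\<close> are the sizes of the first intervals, which
  therefore glue to the uniform measure on \<open>{0..p}\<close>.\<close>

lemma coupled_split_unif:
  assumes IH: "\<forall>s<p. \<forall>m f g h. balanced s m f g h \<longrightarrow> coupled s f g h"
    and jk: "j + k \<le> p"
  shows "coupled p (\<lambda>i. (real p + 1) * unif p i) (\<lambda>i. (real p + 1) * unif j i) (split_unif p j k)"
proof -
  define r where "r = p - j - k"
  have p: "p = j + k + r" using jk by (simp add: r_def)
  have "coupled p (shift r (unif (j + k))) (unif j) (unif k)"
    using coupled_shift[OF coupled_unif[OF IH jk], of r] by (simp add: p)
  from coupled_scale[OF this, of "real j + real k + 1"]
  have A: "coupled p (\<lambda>i. (real j + real k + 1) * shift r (unif (j + k)) i)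
    (\<lambda>i. (real j + real k + 1) * unif j i) (\<lambda>i. (real j + real k + 1) * unif k i)" by simp
  show ?thesis
  proof (cases r)
    case 0
    then show ?thesis
      by (intro coupled_cong[OF A]) (auto simp: p split_unif_def shift_def)
  next
    case (Suc q)
    have "q + j \<le> p" using Suc p by simp
    have "coupled p (shift (Suc k) (unif (q + j))) (unif q) (unif j)"
      using coupled_shift[OF coupled_unif[OF IH \<open>q + j \<le> p\<close>], of "Suc k"]
      by (simp add: p Suc ac_simps)
    from coupled_scale[OF coupled_swap23[OF coupled_swap12[OF this]], of "real r"]
    have B: "coupled p (\<lambda>i. real r * unif q i) (\<lambda>i. real r * unif j i)
      (\<lambda>i. real r * shift (Suc k) (unif (q + j)) i)" by simp
    show ?thesis
    proof (rule coupled_cong[OF coupled_add[OF A B]])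
      fix i
      have "(real (j + k) + 1) * shift r (unif (j + k)) i + (real q + 1) * unif q i =
          (real p + 1) * unif p i"
      proof -
        have "i \<le> q \<longleftrightarrow> i < r" "i \<le> p \<longleftrightarrow> i < r \<or> i - r \<le> j + k" by (auto simp: p Suc)
        then show ?thesis
          unfolding shift_def scale_unif by (simp add: scale_unif del: of_nat_add)
      qed
      then show "(real j + real k + 1) * shift r (unif (j + k)) i + real r * unif q i =
          (real p + 1) * unif p i"
        by (simp add: Suc add.commute)
      show "(real j + real k + 1) * unif j i + real r * unif j i = (real p + 1) * unif j i"
        by (simp add: p algebra_simps)
      have "p - j - k = r" "p - k - 1 = q + j" using p Suc by auto
      then show "(real j + real k + 1) * unif k i + real r * shift (Suc k) (unif (q + j)) i =
          split_unif p j k i"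
        by (simp add: split_unif_def)
    qed
  qed
qed

section \<open>Jumps of decreasing functions\<close>

text \<open>A decreasing, eventually vanishing \<open>f\<close> is the combination of the
  \<open>unif i\<close> with coefficients \<open>(i + 1) * (f i - f (Suc i))\<close>. Its jumps are
  the indices that occur with a non-zero coefficient.\<close>

definition jumps :: "(nat \<Rightarrow> real) \<Rightarrow> nat set" where
  "jumps f = {i. f (Suc i) \<noteq> f i}"

lemma jumps_unif: "jumps (unif k) = {k}"
  by (auto simp: jumps_def unif_def)

lemma jumps_scale: "jumps (\<lambda>i. c * f i) \<subseteq> jumps f"
  by (auto simp: jumps_def)

text \<open>This two-step form, with heights at least 1 and then at most 1, shows both the
  monotonicity and where the jumps can lie.\<close>

lemma split_unif_eq:
  assumes "j + k \<le> p"
  shows "split_unif p j k i = (if i \<le> k then 1 + real j / (real k + 1)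
     else if i \<le> p then 1 - real j / (real p - real k) else 0)"
proof -
  consider "i \<le> k" | "k < i" "i \<le> p" | "p < i" "k < p" | "p < i" "k = p" using assms by linarith
  then show ?thesis
  proof cases
    case 1
    then show ?thesis
      by (simp add: split_unif_def shift_def unif_def add_divide_distrib) (simp add: divide_simps)
  next
    case 2
    then have "\<not> i \<le> k" "\<not> i < Suc k" "i - Suc k \<le> p - k - 1" by auto
    moreover have "real (p - k - 1) + 1 = real p - real k" "real (p - j - k) = real p - real k - real j"
      using assms 2 by (auto simp: of_nat_diff)
    ultimately show ?thesis
      using 2 by (simp add: split_unif_def shift_def unif_def diff_divide_distrib)
  next
    case 3
    then have "\<not> i \<le> k" "\<not> i \<le> p" "\<not> i < Suc k" "\<not> i - Suc k \<le> p - k - 1" by auto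
    then show ?thesis by (simp add: split_unif_def shift_def unif_def)
  next
    case 4
    then have "\<not> i \<le> k" "\<not> i \<le> p" "p - j - k = 0" by auto
    then show ?thesis by (simp add: split_unif_def unif_def)
  qed
qed

lemma antimono_split_unif:
  assumes "j + k \<le> p"
  shows "antimono (split_unif p j k)"
proof -
  define a b where "a = real j / (real k + 1)" and "b = real j / (real p - real k)"
  have "0 \<le> a" "0 \<le> b" "b \<le> 1"
    using assms by (auto simp: a_def b_def divide_le_eq_1)
  then show ?thesis
    unfolding antimono_def split_unif_eq[OF assms] a_def[symmetric] b_def[symmetric] by auto
qed

lemma jumps_split_unif:
  assumes "j + k \<le> p"
  shows "jumps (split_unif p j k) \<subseteq> {k, p}"
proof -
  have "split_unif p j k (Suc i) = split_unif p j k i" if "i \<noteq> k" "i \<noteq> p" for i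
  proof -
    have "Suc i \<le> k \<longleftrightarrow> i \<le> k" "Suc i \<le> p \<longleftrightarrow> i \<le> p" using that by auto
    then show ?thesis by (simp only: split_unif_eq[OF assms])
  qed
  then show ?thesis by (auto simp: jumps_def)
qed

text \<open>Up to its first jump \<open>i\<close> the function is constant, so that part has mean
  \<open>i / 2\<close>, and the rest lies further right. Accordingly the terms
  \<open>(2 * l - i) * f l\<close> sum to 0 over \<open>l \<le> i\<close> and are non-negative
  beyond.\<close>

lemma profile_first_jump:
  assumes "profile p m f" "f 0 > 0"
  obtains i where "i \<le> p" "i \<in> jumps f" "real i * m \<le> 2 * moment p f"
proof -
  define i where "i = (LEAST i. i \<in> jumps f)"
  have const: "f l = f 0" if "\<And>i. i < l \<Longrightarrow> i \<notin> jumps f" for l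
    using that by (induction l) (auto simp: jumps_def)
  have "\<exists>i\<le>p. i \<in> jumps f"
  proof (rule ccontr)
    assume "\<not> ?thesis"
    then have "f (Suc p) = f 0" by (intro const) auto
    then show False using assms by (simp add: profile_def)
  qed
  then obtain i0 where "i0 \<le> p" "i0 \<in> jumps f" by blast
  then have i: "i \<in> jumps f" "i \<le> p"
    unfolding i_def by (auto intro: LeastI order_trans[OF Least_le])
  have below: "f l = f 0" if "l \<le> i" for l
  proof (rule const)
    show "k \<notin> jumps f" if "k < l" for k
      using not_less_Least[of k "\<lambda>i. i \<in> jumps f"] that \<open>l \<le> i\<close> by (auto simp: i_def)
  qed
  have "(\<Sum>l\<le>i. 2 * real l - real i) = 0"
  proof -
    have "(\<Sum>l\<le>n. 2 * real l - c) = (real n + 1) * (real n - c)" for n c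
      by (induction n) (auto simp: algebra_simps)
    then show ?thesis by simp
  qed
  then have "(\<Sum>l\<le>i. (2 * real l - real i) * f 0) = 0"
    by (simp add: sum_distrib_right[symmetric])
  moreover have "(\<Sum>l\<le>i. (2 * real l - real i) * f l) = (\<Sum>l\<le>i. (2 * real l - real i) * f 0)"
    by (intro sum.cong refl) (metis below atMost_iff)
  ultimately have 0: "(\<Sum>l\<le>i. (2 * real l - real i) * f l) = 0" by simp
  have "0 \<le> (\<Sum>l\<in>{Suc i..p}. (2 * real l - real i) * f l)"
    using profile_nonneg[OF assms(1)] by (intro sum_nonneg mult_nonneg_nonneg) auto
  also have "\<dots> = (\<Sum>l\<le>p. (2 * real l - real i) * f l) - (\<Sum>l\<le>i. (2 * real l - real i) * f l)"
  proof -
    have "{..p} = {..i} \<union> {Suc i..p}" using i by auto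
    then show ?thesis by (simp add: sum.union_disjoint)
  qed
  also have "\<dots> = 2 * moment p f - real i * m"
  proof -
    have "real i * m = (\<Sum>l\<le>p. real i * f l)"
      using assms(1) by (auto simp: profile_def sum_distrib_left)
    then show ?thesis
      unfolding 0 by (simp add: moment_def left_diff_distrib sum_subtractf sum_distrib_left mult.assoc)
  qed
  finally show ?thesis using that[OF i(2,1)] by simp
qed

section \<open>Coupled triples with prescribed jumps\<close>

text \<open>The inclusions of jumps allow a positive multiple to be subtracted without losing
  monotonicity. The last condition excludes the zero triple.\<close>

definition piece :: "nat \<Rightarrow> (nat \<Rightarrow> real) \<Rightarrow> (nat \<Rightarrow> real) \<Rightarrow> (nat \<Rightarrow> real) \<Rightarrow>
    (nat \<Rightarrow> real) \<Rightarrow> (nat \<Rightarrow> real) \<Rightarrow> (nat \<Rightarrow> real) \<Rightarrow> bool" where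
  "piece p f g h f' g' h' \<longleftrightarrow> coupled p f' g' h' \<and> antimono f' \<and> antimono g' \<and> antimono h' \<and>
     jumps f' \<subseteq> jumps f \<and> jumps g' \<subseteq> jumps g \<and> jumps h' \<subseteq> jumps h \<and> jumps f' \<union> jumps g' \<union> jumps h' \<noteq> {}"

lemma piece_swap12: "piece p f g h f' g' h' \<Longrightarrow> piece p g f h g' f' h'"
  and piece_swap23: "piece p f g h f' g' h' \<Longrightarrow> piece p f h g f' h' g'"
  by (auto simp: piece_def intro: coupled_swap12 coupled_swap23)

lemma antimono_scale:
  fixes f :: "nat \<Rightarrow> real"
  shows "antimono f \<Longrightarrow> 0 \<le> c \<Longrightarrow> antimono (\<lambda>i. c * f i)"
  by (auto simp: antimono_def mult_left_mono)

lemma piece_split_unif: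
  assumes IH: "\<forall>s<p. \<forall>m f g h. balanced s m f g h \<longrightarrow> coupled s f g h"
    and "j + k \<le> p" "p \<in> jumps f" "j \<in> jumps g" "k \<in> jumps h" "p \<in> jumps h"
  shows "\<exists>f' g' h'. piece p f g h f' g' h'"
proof -
  have "p \<in> jumps (\<lambda>i. (real p + 1) * unif p i)" by (simp add: jumps_def unif_def)
  then have "piece p f g h (\<lambda>i. (real p + 1) * unif p i) (\<lambda>i. (real p + 1) * unif j i) (split_unif p j k)"
    unfolding piece_def
    using coupled_split_unif[OF IH \<open>j + k \<le> p\<close>] antimono_split_unif[OF \<open>j + k \<le> p\<close>]
      jumps_split_unif[OF \<open>j + k \<le> p\<close>] assms(3-)
      jumps_scale[of "real p + 1" "unif p"] jumps_scale[of "real p + 1" "unif j"]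
    by (auto simp: jumps_unif intro!: antimono_scale antimono_unif)
  then show ?thesis by blast
qed

lemma ex_piece:
  assumes IH: "\<forall>s<p. \<forall>m f g h. balanced s m f g h \<longrightarrow> coupled s f g h"
    and bal: "balanced p m f g h" and "p > 0" and top: "f p > 0" "h p > 0"
  shows "\<exists>f' g' h'. piece p f g h f' g' h'"
proof -
  have pr: "profile p m f" "profile p m g" "profile p m h"
    and mom: "moment p f + moment p g + moment p h = real p * m"
    using bal by (auto simp: balanced_def)
  have f0: "f 0 > 0" and h0: "h 0 > 0"
    using top profile_mono[OF pr(1), of 0 p] profile_mono[OF pr(3), of 0 p] by auto
  have "f 0 \<le> (\<Sum>i\<le>p. f i)"
    using profile_nonneg[OF pr(1)] by (intro member_le_sum) auto
  then have m: "m > 0" using f0 pr(1) by (simp add: profile_def)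
  have g0: "g 0 > 0"
  proof (rule ccontr)
    assume "\<not> g 0 > 0"
    then have "g i = 0" for i
      using profile_mono[OF pr(2), of 0 i] profile_nonneg[OF pr(2), of i] by simp
    then show False using pr(2) m by (simp add: profile_def)
  qed
  obtain i where i: "i \<le> p" "i \<in> jumps f" "real i * m \<le> 2 * moment p f"
    by (rule profile_first_jump[OF pr(1) f0])
  obtain j where j: "j \<le> p" "j \<in> jumps g" "real j * m \<le> 2 * moment p g"
    by (rule profile_first_jump[OF pr(2) g0])
  obtain k where k: "k \<le> p" "k \<in> jumps h" "real k * m \<le> 2 * moment p h"
    by (rule profile_first_jump[OF pr(3) h0])
  have "(real i + real j + real k) * m \<le> (2 * real p) * m"
    using i j k mom by (simp add: algebra_simps)
  then have sum: "i + j + k \<le> 2 * p" using m by (simp add: mult_le_cancel_right)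
  have pj: "p \<in> jumps f" "p \<in> jumps h"
    using pr(1,3) top by (auto simp: jumps_def profile_def)
  \<comment> \<open>In the first three cases \<open>split_unif\<close> serves: the measure taken
    uniform on \<open>{0..p}\<close> is \<open>f\<close>, \<open>h\<close>, \<open>g\<close>
    respectively. Outside the first two cases, \<open>j = p\<close> forces
    \<open>i + k \<le> p\<close>, while \<open>i = p\<close> and \<open>k = p\<close> are impossible
    since \<open>i + j + k \<le> 2 * p\<close>.\<close>
  consider "j + k \<le> p" | "i + j \<le> p" | "j = p" "i + k \<le> p" | "j < p" "i < p" "k < p" "p < j + k"
    using sum i j k by linarith
  then show ?thesis
  proof cases
    case 1
    then show ?thesis using piece_split_unif[OF IH 1 pj(1) j(2) k(2) pj(2)] by blast
  next
    case 2
    then have "j + i \<le> p" by simp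
    from piece_split_unif[OF IH this pj(2) j(2) i(2) pj(1)]
    show ?thesis by (blast intro: piece_swap12 piece_swap23)
  next
    case 3
    then have "k + i \<le> p" by simp
    from piece_split_unif[OF IH this _ k(2) i(2) pj(1), of g]
    show ?thesis using 3(1) j(2) by (blast intro: piece_swap12 piece_swap23)
  next
    case 4
    \<comment> \<open>These weights give \<open>F\<close> the mass \<open>a + b = p - i\<close> and
      satisfy \<open>a * i + b * p = (p - i) * (2 * p - j - k)\<close>, which is the mean condition
      against \<open>unif j\<close> and \<open>unif k\<close> scaled to the same mass. Only
      \<open>F\<close> can charge \<open>p\<close>, so peeling applies.\<close>
    define a b where "a = real (j + k - p)" and "b = real (2 * p - i - j - k)"
    have ab: "a = real j + real k - real p" "b = 2 * real p - real i - real j - real k" "0 < a" "0 \<le> b"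
      using 4 sum by (auto simp: a_def b_def of_nat_diff)
    define F where "F = (\<lambda>l. a * unif i l + b * unif p l)"
    define c where "c = real p - real i"
    have c: "c > 0" using 4 by (simp add: c_def)
    have pF: "profile p c F"
      using profile_unif[OF i(1)] profile_unif[of p p] ab
      by (auto simp: F_def profile_def sum.distrib sum_distrib_left[symmetric] c_def antimono_def
          intro!: add_mono mult_left_mono)
    have pc: "profile p c (\<lambda>l. c * unif q l)" if "q \<le> p" for q
      using profile_unif[OF that] c by (auto simp: profile_def sum_distrib_left[symmetric] antimono_scale)
    have mF: "moment p F = a * (real i / 2) + b * (real p / 2)"
    proof -
      have "moment p F = a * moment p (unif i) + b * moment p (unif p)"
        by (simp add: moment_def F_def algebra_simps sum.distrib sum_distrib_left)
      then show ?thesis using i by (simp add: moment_unif)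
    qed
    have mc: "moment p (\<lambda>l. c * unif q l) = c * (real q / 2)" if "q \<le> p" for q
    proof -
      have "moment p (\<lambda>l. c * unif q l) = c * moment p (unif q)"
        by (simp add: moment_def algebra_simps sum_distrib_left)
      then show ?thesis using that by (simp add: moment_unif)
    qed
    have bal': "balanced p c F (\<lambda>l. c * unif j l) (\<lambda>l. c * unif k l)"
      unfolding balanced_def using pF pc j(1) k(1)
      by (simp add: mF mc) (simp add: ab c_def field_simps)
    obtain s where s: "p = Suc s" using \<open>p > 0\<close> by (cases p) auto
    have "coupled p F (\<lambda>l. c * unif j l) (\<lambda>l. c * unif k l)"
      unfolding s
    proof (rule coupled_peel)
      show "\<forall>m f g h. balanced s m f g h \<longrightarrow> coupled s f g h"
        using s IH by blast
    qed (use bal' 4 s in \<open>auto simp: unif_def\<close>)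
    moreover have "jumps F \<subseteq> {i, p}" by (auto simp: F_def jumps_def unif_def)
    moreover have "j \<in> jumps (\<lambda>l. c * unif j l)" using c by (simp add: jumps_def unif_def)
    ultimately have "piece p f g h F (\<lambda>l. c * unif j l) (\<lambda>l. c * unif k l)"
      unfolding piece_def using pF pc j k i pj jumps_scale[of c "unif j"] jumps_scale[of c "unif k"]
      by (auto simp: jumps_unif profile_def)
    then show ?thesis by blast
  qed
qed

section \<open>Subtracting a triple to destroy a jump\<close>

text \<open>At a jump \<open>i\<close> of \<open>f'\<close>, the multiple of \<open>f'\<close> that
  uses up the drop of \<open>f\<close> after \<open>i\<close>.\<close>

definition drop_ratio :: "(nat \<Rightarrow> real) \<Rightarrow> (nat \<Rightarrow> real) \<Rightarrow> nat \<Rightarrow> real" where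
  "drop_ratio f f' i = (f i - f (Suc i)) / (f' i - f' (Suc i))"

text \<open>Away from the jumps of \<open>f'\<close> the drops of \<open>f\<close> are unchanged. At
  them the bound on \<open>t\<close> keeps the drop non-negative, and equality makes it 0.\<close>

lemma subtract_piece:
  assumes "antimono f'" "antimono f" "jumps f' \<subseteq> jumps f" "\<And>i. i \<in> jumps f' \<Longrightarrow> t \<le> drop_ratio f f' i"
  shows "antimono (\<lambda>i. f i - t * f' i)"
    and "jumps (\<lambda>i. f i - t * f' i) \<subseteq> jumps f - {i \<in> jumps f'. t = drop_ratio f f' i}"
proof -
  have le: "f' (Suc i) \<le> f' i" for i using assms(1) by (simp add: antimono_def)
  have "t * (f' i - f' (Suc i)) \<le> f i - f (Suc i)" for i
  proof (cases "i \<in> jumps f'")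
    case True
    then have "f' i - f' (Suc i) > 0" using le[of i] by (simp add: jumps_def)
    then show ?thesis using assms(4)[OF True] by (simp add: drop_ratio_def pos_le_divide_eq)
  next
    case False
    then show ?thesis using assms(2) by (simp add: jumps_def antimono_def)
  qed
  then show "antimono (\<lambda>i. f i - t * f' i)"
    unfolding antimono_iff_le_Suc by (simp add: algebra_simps)
  show "jumps (\<lambda>i. f i - t * f' i) \<subseteq> jumps f - {i \<in> jumps f'. t = drop_ratio f f' i}"
  proof
    fix i assume i: "i \<in> jumps (\<lambda>i. f i - t * f' i)"
    have "i \<in> jumps f" using i assms(3) by (auto simp: jumps_def)
    moreover have "t \<noteq> drop_ratio f f' i" if "i \<in> jumps f'"
    proof
      assume "t = drop_ratio f f' i"
      moreover have "f' i - f' (Suc i) \<noteq> 0" using that by (simp add: jumps_def)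
      ultimately have "t * (f' i - f' (Suc i)) = f i - f (Suc i)" by (simp add: drop_ratio_def)
      then show False using i by (simp add: jumps_def algebra_simps)
    qed
    ultimately show "i \<in> jumps f - {i \<in> jumps f'. t = drop_ratio f f' i}" by blast
  qed
qed

lemma finite_jumps:
  assumes "profile p m f"
  shows "finite (jumps f)"
proof (rule finite_subset)
  show "jumps f \<subseteq> {..p}"
  proof
    fix i assume "i \<in> jumps f"
    then show "i \<in> {..p}" using assms by (cases "i > p") (auto simp: jumps_def profile_def)
  qed
qed simp

lemma subtract_balanced_piece:
  assumes bal: "balanced p m f g h" and pc: "piece p f g h f' g' h'"
  obtains t m' where "0 \<le> t"
    "balanced p m' (\<lambda>i. f i - t * f' i) (\<lambda>i. g i - t * g' i) (\<lambda>i. h i - t * h' i)"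
    "card (jumps (\<lambda>i. f i - t * f' i)) + card (jumps (\<lambda>i. g i - t * g' i)) +
       card (jumps (\<lambda>i. h i - t * h' i)) < card (jumps f) + card (jumps g) + card (jumps h)"
proof -
  have pr: "profile p m f" "profile p m g" "profile p m h"
    and mom: "moment p f + moment p g + moment p h = real p * m"
    using bal by (auto simp: balanced_def)
  have am: "antimono f" "antimono g" "antimono h" using pr by (auto simp: profile_def)
  have y: "coupled p f' g' h'" "antimono f'" "antimono g'" "antimono h'"
    "jumps f' \<subseteq> jumps f" "jumps g' \<subseteq> jumps g" "jumps h' \<subseteq> jumps h" "jumps f' \<union> jumps g' \<union> jumps h' \<noteq> {}"
    using pc by (auto simp: piece_def)
  note fin = finite_jumps[OF pr(1)] finite_jumps[OF pr(2)] finite_jumps[OF pr(3)]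
  define R where "R = drop_ratio f f' ` jumps f' \<union> drop_ratio g g' ` jumps g' \<union> drop_ratio h h' ` jumps h'"
  have R: "finite R" "R \<noteq> {}"
    using y fin by (auto simp: R_def intro: finite_subset)
  \<comment> \<open>The largest multiple that keeps all three remainders decreasing. It equals one
    of the ratios, so at least one jump disappears.\<close>
  define t where "t = Min R"
  have tR: "t \<in> R" and tmin: "\<And>r. r \<in> R \<Longrightarrow> t \<le> r" using R by (auto simp: t_def)
  have t0: "0 \<le> t"
    using tR am y(2-4) by (auto simp: R_def drop_ratio_def antimono_def)
  have tf: "t \<le> drop_ratio f f' i" if "i \<in> jumps f'" for i using that by (intro tmin) (auto simp: R_def)
  have tg: "t \<le> drop_ratio g g' i" if "i \<in> jumps g'" for i using that by (intro tmin) (auto simp: R_def)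
  have th: "t \<le> drop_ratio h h' i" if "i \<in> jumps h'" for i using that by (intro tmin) (auto simp: R_def)
  note sf = subtract_piece[OF y(2) am(1) y(5) tf]
  note sg = subtract_piece[OF y(3) am(2) y(6) tg]
  note sh = subtract_piece[OF y(4) am(3) y(7) th]
  have le: "card (jumps (\<lambda>i. f i - t * f' i)) \<le> card (jumps f)"
    "card (jumps (\<lambda>i. g i - t * g' i)) \<le> card (jumps g)"
    "card (jumps (\<lambda>i. h i - t * h' i)) \<le> card (jumps h)"
    using sf(2) sg(2) sh(2) fin by (auto intro!: card_mono)
  consider i where "i \<in> jumps f'" "t = drop_ratio f f' i" | i where "i \<in> jumps g'" "t = drop_ratio g g' i"
    | i where "i \<in> jumps h'" "t = drop_ratio h h' i"
    using tR by (auto simp: R_def)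
  then have less: "card (jumps (\<lambda>i. f i - t * f' i)) + card (jumps (\<lambda>i. g i - t * g' i)) +
       card (jumps (\<lambda>i. h i - t * h' i)) < card (jumps f) + card (jumps g) + card (jumps h)"
  proof cases
    case 1
    then have "card (jumps (\<lambda>i. f i - t * f' i)) < card (jumps f)"
      using sf(2) y(5) fin by (intro psubset_card_mono) auto
    then show ?thesis using le by simp
  next
    case 2
    then have "card (jumps (\<lambda>i. g i - t * g' i)) < card (jumps g)"
      using sg(2) y(6) fin by (intro psubset_card_mono) auto
    then show ?thesis using le by simp
  next
    case 3
    then have "card (jumps (\<lambda>i. h i - t * h' i)) < card (jumps h)"
      using sh(2) y(7) fin by (intro psubset_card_mono) auto
    then show ?thesis using le by simp
  qed
  note mm = coupled_mass_moment[OF y(1)]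
  have md: "moment p (\<lambda>i. F i - t * G i) = moment p F - t * moment p G" for F G
    by (simp add: moment_def algebra_simps sum_subtractf sum_distrib_left)
  have "moment p f - t * moment p f' + (moment p g - t * moment p g') + (moment p h - t * moment p h')
      = real p * m - t * (real p * (\<Sum>i\<le>p. f' i))"
    unfolding mom[symmetric] mm(3)[symmetric] by (simp add: algebra_simps)
  then have "balanced p (m - t * (\<Sum>i\<le>p. f' i))
      (\<lambda>i. f i - t * f' i) (\<lambda>i. g i - t * g' i) (\<lambda>i. h i - t * h' i)"
    using pr sf(1) sg(1) sh(1) mm(1,2,4-6)
    by (simp add: balanced_def profile_def md sum_subtractf sum_distrib_left[symmetric] algebra_simps)
  from that[OF t0 this less] show ?thesis .
qed

section \<open>The double induction\<close>

lemma balanced_coupled: "balanced s m f g h \<Longrightarrow> coupled s f g h"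
proof (induction s arbitrary: m f g h rule: less_induct)
  case (less p)
  have IH: "\<forall>s<p. \<forall>m f g h. balanced s m f g h \<longrightarrow> coupled s f g h"
    using less.IH by blast
  show ?case
  proof (cases "p = 0")
    case True
    have "0 \<le> m" using less.prems True profile_nonneg[of 0 m f 0] by (simp add: balanced_def profile_def)
    show ?thesis
      unfolding True
      by (rule coupled_cong[OF coupled.add_point[OF coupled.zero, of 0 0 0 0 m]])
        (use less.prems True \<open>0 \<le> m\<close> in \<open>auto simp: balanced_def profile_def\<close>)
  next
    case False
    then obtain s where s: "p = Suc s" by (cases p) auto
    have IHs: "\<forall>m f g h. balanced s m f g h \<longrightarrow> coupled s f g h"
      using IH s by blast
    show ?thesis
      using less.prems
    \<comment> \<open>The inner induction keeps \<open>p\<close> fixed and counts the jumps of all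
      three measures; peeling and the construction of pieces use the outer hypothesis.\<close>
    proof (induction "card (jumps f) + card (jumps g) + card (jumps h)" arbitrary: m f g h rule: less_induct)
      case (less f g h m)
      note bal = less.prems
      have nn: "0 \<le> f p" "0 \<le> g p" "0 \<le> h p"
        using bal by (auto simp: balanced_def intro: profile_nonneg)
      \<comment> \<open>Either two of the values at \<open>p\<close> vanish and the third measure
        can be peeled, or two are positive and a piece exists.\<close>
      consider "g p = 0" "h p = 0" | "f p = 0" "h p = 0" | "f p = 0" "g p = 0"
        | "\<exists>f' g' h'. piece p f g h f' g' h'"
      proof -
        have "\<exists>f' g' h'. piece p f g h f' g' h'" if "f p > 0" "h p > 0"
          using ex_piece[OF IH bal _ that] False by blast
        moreover have "\<exists>f' g' h'. piece p f g h f' g' h'" if "f p > 0" "g p > 0"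
          using ex_piece[OF IH balanced_swap23[OF bal] _ that] False by (blast intro: piece_swap23)
        moreover have "\<exists>f' g' h'. piece p f g h f' g' h'" if "g p > 0" "h p > 0"
          using ex_piece[OF IH balanced_swap12[OF bal] _ that] False by (blast intro: piece_swap12)
        ultimately show ?thesis using that nn by (metis less_eq_real_def)
      qed
      then show ?case
      proof cases
        case 1
        then show ?thesis using coupled_peel[OF IHs] bal s by blast
      next
        case 2
        then show ?thesis
          using coupled_peel[OF IHs balanced_swap12[OF bal[unfolded s]]] s by (blast intro: coupled_swap12)
      next
        case 3
        have "balanced (Suc s) m h f g"
          using bal s by (blast intro: balanced_swap12 balanced_swap23)
        then show ?thesis
          using coupled_peel[OF IHs] 3 s by (blast intro: coupled_swap12 coupled_swap23)
      next
        case 4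
        then obtain f' g' h' where pc: "piece p f g h f' g' h'" by blast
        obtain t m' where t: "0 \<le> t"
          and bal': "balanced p m' (\<lambda>i. f i - t * f' i) (\<lambda>i. g i - t * g' i) (\<lambda>i. h i - t * h' i)"
          and lt: "card (jumps (\<lambda>i. f i - t * f' i)) + card (jumps (\<lambda>i. g i - t * g' i)) +
            card (jumps (\<lambda>i. h i - t * h' i)) < card (jumps f) + card (jumps g) + card (jumps h)"
          by (rule subtract_balanced_piece[OF bal pc])
        have "coupled p f' g' h'" using pc by (simp add: piece_def)
        from coupled_add[OF less.hyps[OF lt bal'] coupled_scale[OF this t]]
        show ?thesis by simp
      qed
    qed
  qed
qed

section \<open>From weights to random variables\<close>

text \<open>Writing the marginals as sums over a fixed finite box lets the single computation
  \<open>eq\<close> treat all three projections. Naturals with sum \<open>s\<close> are at most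
  \<open>s\<close>, so every point added lies in the box.\<close>

lemma coupled_weights:
  assumes "coupled s f g h"
  obtains w :: "nat \<times> nat \<times> nat \<Rightarrow> real" where "\<And>t. 0 \<le> w t"
    "\<And>i j k. i + j + k \<noteq> s \<Longrightarrow> w (i, j, k) = 0"
    "\<And>i. f i = (\<Sum>t\<in>{..s} \<times> {..s} \<times> {..s}. if fst t = i then w t else 0)"
    "\<And>j. g j = (\<Sum>t\<in>{..s} \<times> {..s} \<times> {..s}. if fst (snd t) = j then w t else 0)"
    "\<And>k. h k = (\<Sum>t\<in>{..s} \<times> {..s} \<times> {..s}. if snd (snd t) = k then w t else 0)"
proof -
  let ?D = "{..s} \<times> {..s} \<times> {..s}"
  have "\<exists>w :: nat \<times> nat \<times> nat \<Rightarrow> real. (\<forall>t. 0 \<le> w t) \<and> (\<forall>i j k. i + j + k \<noteq> s \<longrightarrow> w (i, j, k) = 0) \<and>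
    (\<forall>i. f i = (\<Sum>t\<in>?D. if fst t = i then w t else 0)) \<and>
    (\<forall>j. g j = (\<Sum>t\<in>?D. if fst (snd t) = j then w t else 0)) \<and>
    (\<forall>k. h k = (\<Sum>t\<in>?D. if snd (snd t) = k then w t else 0))"
    using assms
  proof (induction rule: coupled.induct)
    case zero
    then show ?case by (intro exI[of _ "\<lambda>_. 0"]) simp
  next
    case (add_point f g h i j k c)
    then obtain w where w: "\<forall>t. 0 \<le> w t" "\<forall>i j k. i + j + k \<noteq> s \<longrightarrow> w (i, j, k) = 0"
      "\<forall>i. f i = (\<Sum>t\<in>?D. if fst t = i then w t else 0)"
      "\<forall>j. g j = (\<Sum>t\<in>?D. if fst (snd t) = j then w t else 0)"
      "\<forall>k. h k = (\<Sum>t\<in>?D. if snd (snd t) = k then w t else 0)" by blast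
    let ?w = "\<lambda>t. w t + (if t = (i, j, k) then c else 0)"
    have in_D: "(i, j, k) \<in> ?D" using add_point.hyps by auto
    have eq: "(\<Sum>t\<in>?D. if \<phi> t = l then ?w t else 0) =
        (\<Sum>t\<in>?D. if \<phi> t = l then w t else 0) + (if \<phi> (i, j, k) = l then c else 0)" for \<phi> and l :: nat
    proof -
      have "(\<Sum>t\<in>?D. if \<phi> t = l then ?w t else 0) =
          (\<Sum>t\<in>?D. (if \<phi> t = l then w t else 0) + (if t = (i, j, k) then if \<phi> (i, j, k) = l then c else 0 else 0))"
        by (rule sum.cong) auto
      then show ?thesis using in_D by (simp only: sum.distrib) (simp add: sum.delta)
    qed
    show ?case
      by (rule exI[of _ ?w]) (use w add_point.hyps in \<open>auto simp only: eq\<close>, auto)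
  qed
  then show ?thesis using that by blast
qed

text \<open>The weights form a distribution \<open>P\<close> on triples of naturals, and its three
  coordinates are the required random variables.\<close>

lemma coupled_compatible:
  fixes \<pi>\<^sub>1 \<pi>\<^sub>2 \<pi>\<^sub>3 :: "int pmf"
  assumes cpl: "coupled s (\<lambda>i. pmf \<pi>\<^sub>1 (int i)) (\<lambda>i. pmf \<pi>\<^sub>2 (int i)) (\<lambda>i. pmf \<pi>\<^sub>3 (int i))"
    and supp: "set_pmf \<pi>\<^sub>1 \<subseteq> {0..int s}" "set_pmf \<pi>\<^sub>2 \<subseteq> {0..int s}" "set_pmf \<pi>\<^sub>3 \<subseteq> {0..int s}"
  shows "compatible \<pi>\<^sub>1 \<pi>\<^sub>2 \<pi>\<^sub>3"
proof -
  let ?D = "{..s} \<times> {..s} \<times> {..s}"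
  obtain w :: "nat \<times> nat \<times> nat \<Rightarrow> real" where w: "\<And>t. 0 \<le> w t"
    "\<And>i j k. i + j + k \<noteq> s \<Longrightarrow> w (i, j, k) = 0"
    "\<And>i. pmf \<pi>\<^sub>1 (int i) = (\<Sum>t\<in>?D. if fst t = i then w t else 0)"
    "\<And>j. pmf \<pi>\<^sub>2 (int j) = (\<Sum>t\<in>?D. if fst (snd t) = j then w t else 0)"
    "\<And>k. pmf \<pi>\<^sub>3 (int k) = (\<Sum>t\<in>?D. if snd (snd t) = k then w t else 0)"
    using coupled_weights[OF cpl] by blast
  have w0: "w t = 0" if "t \<notin> ?D" for t
    using that by (cases t) (auto intro!: w(2))
  \<comment> \<open>Each triple of the box has exactly one first coordinate, so the total weight is
    the mass of \<open>\<pi>\<^sub>1\<close>.\<close>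
  have "(\<Sum>i\<le>s. pmf \<pi>\<^sub>1 (int i)) = (\<Sum>x\<in>{0..int s}. pmf \<pi>\<^sub>1 x)"
    by (rule sum.reindex_bij_witness[of _ nat int]) auto
  also have "\<dots> = 1" using supp(1) by (intro sum_pmf_eq_1) auto
  finally have "1 = (\<Sum>i\<le>s. \<Sum>t\<in>?D. if fst t = i then w t else 0)" by (simp add: w)
  also have "\<dots> = (\<Sum>t\<in>?D. \<Sum>i\<le>s. if fst t = i then w t else 0)" by (rule sum.swap)
  also have "\<dots> = (\<Sum>t\<in>?D. w t)" by (intro sum.cong) auto
  finally have one: "(\<Sum>t\<in>?D. w t) = 1" by simp
  define P where "P = embed_pmf w"
  have pmfP: "pmf P t = w t" for t
    unfolding P_def
  proof (rule pmf_embed_pmf)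
    have "(\<integral>\<^sup>+ x. ennreal (w x) \<partial>count_space UNIV) = (\<integral>\<^sup>+ x. ennreal (w x) \<partial>count_space ?D)"
      by (rule nn_integral_count_space_eq) (auto simp: w0)
    also have "\<dots> = 1"
      using one w(1) by (simp add: nn_integral_count_space_finite sum_ennreal)
    finally show "(\<integral>\<^sup>+ x. ennreal (w x) \<partial>count_space UNIV) = 1" .
  qed (rule w(1))
  have setP: "set_pmf P \<subseteq> ?D" using w0 pmfP by (metis set_pmf_iff subsetI)
  have prob: "measure P A = (\<Sum>t\<in>?D. if t \<in> A then w t else 0)" for A
  proof -
    have "measure P A = measure P (A \<inter> ?D)"
      using setP by (intro measure_pmf.finite_measure_eq_AE) (auto simp: AE_measure_pmf_iff)
    also have "\<dots> = (\<Sum>t\<in>A \<inter> ?D. w t)" by (subst measure_measure_pmf_finite) (auto simp: pmfP)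
    also have "\<dots> = (\<Sum>t\<in>?D. if t \<in> A then w t else 0)"
      by (simp add: sum.If_cases Int_commute)
    finally show ?thesis .
  qed
  have marg: "map_pmf (int \<circ> \<phi>) P = \<pi>"
    if "\<And>i. pmf \<pi> (int i) = (\<Sum>t\<in>?D. if \<phi> t = i then w t else 0)" "set_pmf \<pi> \<subseteq> {0..int s}" for \<phi> \<pi>
  proof (rule pmf_eqI)
    fix x
    show "pmf (map_pmf (int \<circ> \<phi>) P) x = pmf \<pi> x"
    proof (cases "x < 0")
      case True
      then have "(int \<circ> \<phi>) -` {x} = {}" "x \<notin> set_pmf \<pi>" using that(2) by auto
      then show ?thesis by (simp add: pmf_map set_pmf_iff)
    next
      case False
      then have "pmf \<pi> x = (\<Sum>t\<in>?D. if \<phi> t = nat x then w t else 0)" using that(1)[of "nat x"] by simp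
      also have "\<dots> = pmf (map_pmf (int \<circ> \<phi>) P) x"
        unfolding pmf_map prob using False by (intro sum.cong) auto
      finally show ?thesis by simp
    qed
  qed
  have distr: "distr (measure_pmf P) (count_space UNIV) (int \<circ> \<phi>) = measure_pmf \<pi>"
    if "map_pmf (int \<circ> \<phi>) P = \<pi>" for \<phi> \<pi>
    using map_pmf_rep_eq[of "int \<circ> \<phi>" P] that by simp
  show ?thesis
  proof (rule compatibleI)
    show "prob_space (measure_pmf P)" by (rule measure_pmf.prob_space_axioms)
    show "distr (measure_pmf P) (count_space UNIV) (int \<circ> fst) = measure_pmf \<pi>\<^sub>1"
      using w(3) supp(1) by (intro distr marg)
    show "distr (measure_pmf P) (count_space UNIV) (int \<circ> (\<lambda>t. fst (snd t))) = measure_pmf \<pi>\<^sub>2"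
      using w(4) supp(2) by (intro distr marg)
    show "distr (measure_pmf P) (count_space UNIV) (int \<circ> (\<lambda>t. snd (snd t))) = measure_pmf \<pi>\<^sub>3"
      using w(5) supp(3) by (intro distr marg)
    show "AE t in measure_pmf P. (int \<circ> fst) t + (int \<circ> (\<lambda>t. fst (snd t))) t +
        (int \<circ> (\<lambda>t. snd (snd t))) t = int s"
      unfolding AE_measure_pmf_iff
    proof
      fix t assume "t \<in> set_pmf P"
      then have "fst t + fst (snd t) + snd (snd t) = s"
        using w(2) by (cases t) (auto simp: set_pmf_iff pmfP)
      then show "(int \<circ> fst) t + (int \<circ> (\<lambda>t. fst (snd t))) t + (int \<circ> (\<lambda>t. snd (snd t))) t = int s"
        by (simp flip: of_nat_add)
    qed
  qed simp_all
qed

text \<open>Monotonicity on the interval extends to all naturals because the probabilities are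
  non-negative and vanish beyond \<open>s\<close>.\<close>

lemma pmf_profile:
  assumes "set_pmf \<pi> \<subseteq> {0..<int (Suc s)}" "antimono_on {0..<int (Suc s)} (pmf \<pi>)"
  shows "profile s 1 (\<lambda>i. pmf \<pi> (int i))"
    and "moment s (\<lambda>i. pmf \<pi> (int i)) = measure_pmf.expectation \<pi> real_of_int"
proof -
  have z: "pmf \<pi> (int i) = 0" if "i > s" for i
    using assms(1) that by (auto simp: pmf_eq_0_set_pmf)
  have "antimono (\<lambda>i. pmf \<pi> (int i))"
    unfolding antimono_iff_le_Suc
  proof
    fix i
    show "pmf \<pi> (int (Suc i)) \<le> pmf \<pi> (int i)"
    proof (cases "Suc i > s")
      case False
      then show ?thesis using monotone_onD[OF assms(2), of "int i" "int (Suc i)"] by simp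
    qed (simp add: z del: of_nat_Suc)
  qed
  moreover have eq: "(\<Sum>i\<le>s. F (int i)) = (\<Sum>x\<in>{0..<int (Suc s)}. F x)" for F :: "int \<Rightarrow> real"
    by (rule sum.reindex_bij_witness[of _ nat int]) auto
  moreover have "(\<Sum>x\<in>{0..<int (Suc s)}. pmf \<pi> x) = 1"
    using assms(1) by (intro sum_pmf_eq_1) auto
  ultimately show "profile s 1 (\<lambda>i. pmf \<pi> (int i))" using z by (simp add: profile_def)
  have "measure_pmf.expectation \<pi> real_of_int = (\<Sum>x\<in>{0..<int (Suc s)}. real_of_int x * pmf \<pi> x)"
    using assms(1) by (subst integral_measure_pmf_real) (auto intro: sum.cong)
  then show "moment s (\<lambda>i. pmf \<pi> (int i)) = measure_pmf.expectation \<pi> real_of_int"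
    unfolding moment_def using eq[of "\<lambda>x. real_of_int x * pmf \<pi> x"] by simp
qed

theorem theorem4:
  fixes p :: nat and \<pi>\<^sub>1 \<pi>\<^sub>2 \<pi>\<^sub>3 :: "int pmf"
  assumes "p > 0"
    and "set_pmf \<pi>\<^sub>1 \<subseteq> {0..<int p}" "set_pmf \<pi>\<^sub>2 \<subseteq> {0..<int p}" "set_pmf \<pi>\<^sub>3 \<subseteq> {0..<int p}"
    and "antimono_on {0..<int p} (pmf \<pi>\<^sub>1)"
    and "antimono_on {0..<int p} (pmf \<pi>\<^sub>2)"
    and "antimono_on {0..<int p} (pmf \<pi>\<^sub>3)"
    and "measure_pmf.expectation \<pi>\<^sub>1 real_of_int + measure_pmf.expectation \<pi>\<^sub>2 real_of_int
           + measure_pmf.expectation \<pi>\<^sub>3 real_of_int = real p - 1"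
  shows "compatible \<pi>\<^sub>1 \<pi>\<^sub>2 \<pi>\<^sub>3"
proof -
  \<comment> \<open>With \<open>s = p - 1\<close> the condition on the expectations is the moment
    condition of \<open>balanced\<close> for mass 1.\<close>
  obtain s where s: "p = Suc s" using assms(1) by (cases p) auto
  note A = assms(2-)[unfolded s]
  have "balanced s 1 (\<lambda>i. pmf \<pi>\<^sub>1 (int i)) (\<lambda>i. pmf \<pi>\<^sub>2 (int i)) (\<lambda>i. pmf \<pi>\<^sub>3 (int i))"
    using pmf_profile[OF A(1,4)] pmf_profile[OF A(2,5)] pmf_profile[OF A(3,6)] A(7)
    by (simp add: balanced_def)
  moreover have "{0..<int (Suc s)} = {0..int s}" by auto
  ultimately show ?thesis
    using coupled_compatible[OF balanced_coupled] A(1-3) by simp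
qed

end
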